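(* For every odd integer $n \geq 5$, the polynomials $\mathsf{AExc}_n^{+}(s,t)$ and $\mathsf{AExc}_n^{-}(s,t)$ are both (bivariate) gamma positive, and both have the same center of symmetry $(n-1)/2$.
   Context: Let $\mathfrak{S}_n$ be the symmetric group on $[n]=\{1,\dots,n\}$ and $\mathcal{A}_n\subseteq\mathfrak{S}_n$ the alternating group (even permutations). For $\pi\in\mathfrak{S}_n$, $\mathsf{exc}(\pi)=|\{i\in[n]:\pi_i>i\}|$ and $\mathsf{nexc}(\pi)=|\{i\in[n]:\pi_i\le i\}|$. Define $\mathsf{AExc}_n^{+}(s,t)=\sum_{\pi\in\mathcal{A}_n}t^{\mathsf{exc}(\pi)}s^{\mathsf{nexc}(\pi)-1}$ and $\mathsf{AExc}_n^{-}(s,t)=\sum_{\pi\in\mathfrak{S}_n\setminus\mathcal{A}_n}t^{\mathsf{exc}(\pi)}s^{\mathsf{nexc}(\pi)-1}$; these are homogeneous of degree $n-1$. A homogeneous polynomial $f(s,t)$ of degree $d$ is called (bivariate) gamma positive with center of symmetry $d/2$ if $f(s,t)=\sum_{i=0}^{\lfloor d/2\rfloor}\gamma_i\,(st)^i(s+t)^{d-2i}$ with all $\gamma_i\ge 0$. *)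

theory Defs
  imports Complex_Main "HOL-Computational_Algebra.Polynomial" "HOL-Algebra.Sym_Groups"
begin

(* A bivariate polynomial in s and t is an element of R[s][t]:
   the inner indeterminate is s, the outer one is t. *)
type_synonym 'a bipoly = "'a poly poly"

definition var_s :: "real bipoly" where
  "var_s = [:[:0, 1:]:]"

definition var_t :: "real bipoly" where
  "var_t = [:0, 1:]"

definition homogeneous :: "nat \<Rightarrow> real bipoly \<Rightarrow> bool" where
  "homogeneous d f \<longleftrightarrow> (\<forall>i j. coeff (coeff f j) i \<noteq> 0 \<longrightarrow> i + j = d)"

definition gamma_positive_with_center :: "real bipoly \<Rightarrow> real \<Rightarrow> bool" where
  "gamma_positive_with_center f c \<longleftrightarrow>
     (\<exists>d::nat. c = real d / 2 \<and> homogeneous d f \<and>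
       (\<exists>\<gamma>::nat \<Rightarrow> real. (\<forall>i\<le>d div 2. \<gamma> i \<ge> 0) \<and>
          f = (\<Sum>i\<le>d div 2. smult [:\<gamma> i:] ((var_s * var_t) ^ i * (var_s + var_t) ^ (d - 2 * i)))))"

definition exc :: "nat \<Rightarrow> (nat \<Rightarrow> nat) \<Rightarrow> nat" where
  "exc n \<pi> = card {i \<in> {1..n}. \<pi> i > i}"

definition nexc :: "nat \<Rightarrow> (nat \<Rightarrow> nat) \<Rightarrow> nat" where
  "nexc n \<pi> = card {i \<in> {1..n}. \<pi> i \<le> i}"

(* For n \<ge> 1 every permutation of {1..n} satisfies \<pi> n \<le> n, so nexc n \<pi> \<ge> 1 and the
   exponent of s below is never a truncated subtraction. *)
definition AExc_plus :: "nat \<Rightarrow> real bipoly" where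
  "AExc_plus n = (\<Sum>\<pi> \<in> carrier (alt_group n). var_t ^ exc n \<pi> * var_s ^ (nexc n \<pi> - 1))"

definition AExc_minus :: "nat \<Rightarrow> real bipoly" where
  "AExc_minus n =
     (\<Sum>\<pi> \<in> carrier (sym_group n) - carrier (alt_group n). var_t ^ exc n \<pi> * var_s ^ (nexc n \<pi> - 1))"

end

theory Submission imports Defs begin

text \<open>
  Composing a permutation of \<open>{1..n}\<close> with a transposition \<open>(n+1 k)\<close> creates an excedance at \<open>k\<close>
  exactly if \<open>k\<close> was not one already, and it flips the sign. Hence both the sum and the signed sum
  of \<open>t^exc s^(nexc-1)\<close> satisfy a first-order differential recurrence in \<open>n\<close>. The signed one is
  solved by \<open>(s - t)^(n-1)\<close>; on the gamma basis the unsigned one becomes a recurrence for the gamma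
  coefficients. For \<open>n = 2m+1\<close> the signed sum is \<open>((s + t)^2 - 4st)^m\<close>, with gamma coefficients
  \<open>(-4)^i (m choose i)\<close>, so the claim reduces to the bound \<open>4^i (m choose i)\<close> from below on the
  unsigned coefficients, which holds for \<open>m = 2\<close> and propagates through two steps of the recurrence.
\<close>

section \<open>Excedances and the passage from \<open>n\<close> to \<open>Suc n\<close>\<close>

lemma nexc_eq: "nexc n p = n - exc n p"
proof -
  have "{i \<in> {1..n}. p i \<le> i} = {1..n} - {i \<in> {1..n}. p i > i}"
    by auto
  then have "nexc n p = card ({1..n} - {i \<in> {1..n}. p i > i})"
    by (simp add: nexc_def)
  also have "\<dots> = n - exc n p"
    unfolding exc_def by (subst card_Diff_subset) auto
  finally show ?thesis .
qed

text \<open>The largest point \<open>n\<close> is never an excedance. Hence the exponent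
  \<open>nexc n p - 1\<close> of \<open>var_s\<close> is a genuine subtraction.\<close>

lemma exc_less:
  assumes "p permutes {1..n}" "n \<ge> 1"
  shows "exc n p < n"
proof -
  have "p n \<le> n"
    using assms permutes_in_image[OF assms(1), of n] by auto
  then have "n \<in> {1..n} - {i \<in> {1..n}. p i > i}"
    using assms(2) by simp
  then have "{i \<in> {1..n}. p i > i} \<subset> {1..n}"
    by blast
  then have "card {i \<in> {1..n}. p i > i} < card {1..n}"
    by (intro psubset_card_mono) auto
  then show ?thesis by (simp add: exc_def)
qed

lemma exc_Suc_fixed:
  assumes "p permutes {1..n}"
  shows "exc (Suc n) p = exc n p"
proof -
  have "p (Suc n) = Suc n"
    using assms by (simp add: permutes_not_in)
  then have "{i \<in> {1..Suc n}. p i > i} = {i \<in> {1..n}. p i > i}"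
    by (auto simp: le_Suc_eq)
  then show ?thesis by (simp add: exc_def)
qed

text \<open>The composite sends \<open>k\<close> to \<open>Suc n\<close>, which exceeds
  \<open>k\<close>, and \<open>Suc n\<close> to \<open>p k \<le> n\<close>; all other values stay.
  So the new excedance set is the old one with \<open>k\<close> inserted.\<close>

lemma exc_comp_transpose:
  assumes p: "p permutes {1..n}" and k: "k \<in> {1..n}"
  shows "exc (Suc n) (p \<circ> transpose (Suc n) k) = (if p k > k then exc n p else Suc (exc n p))"
proof -
  let ?q = "p \<circ> transpose (Suc n) k"
  have fixed: "p (Suc n) = Suc n"
    using p by (simp add: permutes_not_in)
  have "p k \<le> n"
    using permutes_in_image[OF p] k by auto
  have "i \<in> {i \<in> {1..Suc n}. ?q i > i} \<longleftrightarrow> i \<in> insert k {i \<in> {1..n}. p i > i}" for i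
    using fixed k \<open>p k \<le> n\<close> by (cases "i = k"; cases "i = Suc n") (auto simp: transpose_def)
  then have "{i \<in> {1..Suc n}. ?q i > i} = insert k {i \<in> {1..n}. p i > i}"
    by blast
  then show ?thesis
    using k by (simp add: exc_def card_insert_if)
qed

section \<open>The sign-weighted excedance polynomial and its recurrence\<close>

text \<open>The weight \<open>e\<close> of the odd permutations is a parameter, so that one
  recurrence serves both the unsigned sum (\<open>e = 1\<close>) and the signed sum
  (\<open>e = -1\<close>).\<close>

definition exc_poly :: "real bipoly \<Rightarrow> nat \<Rightarrow> real bipoly" where
  "exc_poly e n = (\<Sum>p | p permutes {1..n}.
     (if evenperm p then 1 else e) * (var_t ^ exc n p * var_s ^ (nexc n p - 1)))"

text \<open>The standard decomposition multiplies by the transposition on the left. Since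
  \<open>transpose (Suc n) (p k) \<circ> p = p \<circ> transpose (Suc n) k\<close>, reindexing
  \<open>k\<close> by \<open>p\<close> moves it to the right, where its effect on excedances is
  known.\<close>

lemma sum_permutes_Suc:
  fixes f :: "(nat \<Rightarrow> nat) \<Rightarrow> 'a::comm_monoid_add"
  shows "(\<Sum>p | p permutes {1..Suc n}. f p) =
    (\<Sum>p | p permutes {1..n}. f p + (\<Sum>k\<in>{1..n}. f (p \<circ> transpose (Suc n) k)))"
proof -
  have eq: "{1..Suc n} = insert (Suc n) {1..n}"
    by auto
  have "(\<Sum>p | p permutes {1..Suc n}. f p) =
      (\<Sum>k\<in>insert (Suc n) {1..n}. \<Sum>p | p permutes {1..n}. f (transpose (Suc n) k \<circ> p))"
    unfolding eq by (rule sum_over_permutations_insert) auto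
  also have "\<dots> = (\<Sum>p | p permutes {1..n}. \<Sum>k\<in>insert (Suc n) {1..n}. f (transpose (Suc n) k \<circ> p))"
    by (rule sum.swap)
  also have "\<dots> = (\<Sum>p | p permutes {1..n}. f p + (\<Sum>k\<in>{1..n}. f (p \<circ> transpose (Suc n) k)))"
  proof (rule sum.cong[OF refl])
    fix p assume "p \<in> {p. p permutes {1..n}}"
    then have p: "p permutes {1..n}" by simp
    have comm: "transpose (Suc n) (p k) \<circ> p = p \<circ> transpose (Suc n) k" for k
    proof -
      have fixed: "p (Suc n) = Suc n" using p by (simp add: permutes_not_in)
      note inj = inj_eq[OF permutes_inj[OF p]]
      have "p x = Suc n \<longleftrightarrow> x = Suc n" for x
        using inj[of x "Suc n"] fixed by simp
      then show ?thesis
        by (simp add: fun_eq_iff transpose_def fixed inj)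
    qed
    have "(\<Sum>k\<in>{1..n}. f (transpose (Suc n) k \<circ> p)) = (\<Sum>k\<in>{1..n}. f (transpose (Suc n) (p k) \<circ> p))"
      using sum.permute[OF p, of "\<lambda>k. f (transpose (Suc n) k \<circ> p)"] by (simp add: comp_def)
    then show "(\<Sum>k\<in>insert (Suc n) {1..n}. f (transpose (Suc n) k \<circ> p)) =
        f p + (\<Sum>k\<in>{1..n}. f (p \<circ> transpose (Suc n) k))"
      by (simp add: comm)
  qed
  finally show ?thesis .
qed

lemma evenperm_comp_transpose:
  assumes "p permutes {1..n}" "k \<in> {1..n}"
  shows "evenperm (p \<circ> transpose (Suc n) k) \<longleftrightarrow> \<not> evenperm p"
proof -
  have "permutation p"
    using assms(1) by (rule permutes_imp_permutation[rotated]) simp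
  then show ?thesis
    using assms(2) by (simp add: evenperm_comp permutation_swap_id evenperm_swap)
qed

lemma pderiv_var_t [simp]: "pderiv var_t = 1"
  and pderiv_var_s [simp]: "pderiv var_s = 0"
  by (simp_all add: var_t_def var_s_def pderiv_pCons one_pCons)

lemma pderiv_var_s_power [simp]: "pderiv (var_s ^ k) = 0"
  by (induction k) (simp_all add: pderiv_mult)

text \<open>The extra factor \<open>f\<close> avoids the exponent \<open>k - 1\<close>. For
  \<open>f = var_t\<close> this says that t d/dt multiplies \<open>t^k\<close> by
  \<open>k\<close>.\<close>

lemma mult_pderiv_power:
  fixes f :: "real bipoly"
  shows "f * pderiv (f ^ k) = of_nat k * f ^ k * pderiv f"
proof (induction k)
  case (Suc k)
  have "f * pderiv (f ^ Suc k) = f * (f * pderiv (f ^ k)) + f ^ Suc k * pderiv f"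
    by (simp add: pderiv_mult algebra_simps)
  then show ?case
    unfolding Suc.IH by (simp add: algebra_simps)
qed simp

text \<open>Let \<open>p\<close> have \<open>x\<close> excedances and weight \<open>w\<close>. The
  permutation \<open>p\<close> itself contributes \<open>s w\<close>; the \<open>x\<close> choices
  of \<open>k\<close> at excedances contribute \<open>e s w\<close> each, and the other
  \<open>n - x\<close> choices \<open>e t w\<close> each. The total is
  \<open>(s + e n t) w + e (s - t) x w\<close>, and \<open>x w\<close> is t d/dt applied to
  \<open>w\<close>.\<close>

lemma exc_poly_Suc:
  assumes e: "e = 1 \<or> e = -1" and n: "n \<ge> 1"
  shows "exc_poly e (Suc n) = (var_s + e * of_nat n * var_t) * exc_poly e n
    + e * (var_s - var_t) * (var_t * pderiv (exc_poly e n))"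
proof -
  define sg where "sg p = (if evenperm p then 1 else e)" for p :: "nat \<Rightarrow> nat"
  define w where "w N p = sg p * (var_t ^ exc N p * var_s ^ (nexc N p - 1))"
    for N and p :: "nat \<Rightarrow> nat"
  have poly: "exc_poly e N = (\<Sum>p | p permutes {1..N}. w N p)" for N
    by (simp add: exc_poly_def w_def sg_def)
  have pd: "var_t * pderiv (w n p) = of_nat (exc n p) * w n p" for p
  proof -
    have [simp]: "pderiv (sg p) = 0" using e by (auto simp: sg_def pderiv_minus)
    have "var_t * pderiv (w n p) =
        sg p * var_s ^ (nexc n p - 1) * (var_t * pderiv (var_t ^ exc n p))"
      by (simp add: w_def pderiv_mult algebra_simps)
    then show ?thesis
      unfolding mult_pderiv_power by (simp add: w_def algebra_simps)
  qed
  have "w (Suc n) p + (\<Sum>k\<in>{1..n}. w (Suc n) (p \<circ> transpose (Suc n) k)) =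
      (var_s + e * of_nat n * var_t) * w n p + e * (var_s - var_t) * (var_t * pderiv (w n p))"
    if p: "p permutes {1..n}" for p
  proof -
    define x where "x = exc n p"
    have x: "x < n" using exc_less[OF p n] by (simp add: x_def)
    \<comment> \<open>In size \<open>Suc n\<close> the exponent of \<open>var_s\<close> is
      \<open>n - x\<close> if the excedance number stays \<open>x\<close>, and
      \<open>n - x - 1\<close> if it grows by one.\<close>
    have s: "var_s ^ (n - x) = var_s * var_s ^ (n - x - 1)"
      using x by (metis Suc_diff_1 power_Suc zero_less_diff)
    have first: "w (Suc n) p = var_s * w n p"
      using x s by (simp add: w_def nexc_eq exc_Suc_fixed[OF p] Suc_diff_le flip: x_def)
    have "w (Suc n) (p \<circ> transpose (Suc n) k) =
        (if p k > k then e * var_s * w n p else e * var_t * w n p)" if k: "k \<in> {1..n}" for k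
    proof -
      have "sg (p \<circ> transpose (Suc n) k) = e * sg p"
        using e evenperm_comp_transpose[OF p k] by (auto simp: sg_def)
      then show ?thesis
        using x s
        by (simp add: w_def nexc_eq exc_comp_transpose[OF p k] Suc_diff_le flip: x_def)
    qed
    then have "(\<Sum>k\<in>{1..n}. w (Suc n) (p \<circ> transpose (Suc n) k)) =
        (\<Sum>k\<in>{1..n}. if p k > k then e * var_s * w n p else e * var_t * w n p)"
      by (rule sum.cong[OF refl])
    also have "\<dots> = of_nat x * (e * var_s * w n p) + of_nat (n - x) * (e * var_t * w n p)"
    proof -
      have "{1..n} \<inter> {k. p k > k} = {k \<in> {1..n}. p k > k}"
        "{1..n} \<inter> - {k. p k > k} = {k \<in> {1..n}. p k \<le> k}" by auto
      moreover have "card {k \<in> {1..n}. p k \<le> k} = n - x"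
        using nexc_eq[of n p] by (simp add: nexc_def x_def)
      ultimately show ?thesis
        by (subst sum.If_cases) (auto simp: x_def exc_def)
    qed
    also have "of_nat (n - x) = (of_nat n - of_nat x :: real bipoly)"
      using x by (simp add: of_nat_diff)
    finally show ?thesis
      unfolding first pd x_def[symmetric] by (simp add: algebra_simps del: o_apply)
  qed
  then show ?thesis
    unfolding poly sum_permutes_Suc
    by (simp add: sum.distrib sum_distrib_left higher_pderiv_sum[of 1, simplified] cong: sum.cong_simp)
qed

lemma exc_poly_1: "exc_poly e (Suc 0) = 1"
proof -
  have "{p. p permutes {Suc 0}} = {id}" by auto
  then show ?thesis
    by (simp add: exc_poly_def nexc_eq exc_def evenperm_id[unfolded id_def] id_def)
qed

text \<open>With \<open>f = (s - t)^d\<close> the derivative term of the recurrence is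
  \<open>d t f\<close>, so the step multiplies \<open>f\<close> by
  \<open>s - (d + 1) t + d t = s - t\<close>.\<close>

lemma exc_poly_minus: "exc_poly (-1) (Suc d) = (var_s - var_t) ^ d"
proof (induction d)
  case 0
  then show ?case by (simp add: exc_poly_1)
next
  case (Suc d)
  have pd: "(var_s - var_t) * pderiv ((var_s - var_t) ^ d) = - of_nat d * (var_s - var_t) ^ d"
    by (simp add: mult_pderiv_power pderiv_diff)
  have "exc_poly (-1) (Suc (Suc d)) = (var_s - of_nat (Suc d) * var_t) * (var_s - var_t) ^ d
      - var_t * ((var_s - var_t) * pderiv ((var_s - var_t) ^ d))"
    by (subst exc_poly_Suc) (simp_all add: Suc.IH algebra_simps)
  also have "\<dots> = (var_s - var_t) ^ Suc d"
    unfolding pd by (simp add: algebra_simps)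
  finally show ?case .
qed

section \<open>Gamma expansion of the unsigned sum\<close>

definition gamma_basis :: "nat \<Rightarrow> nat \<Rightarrow> real bipoly" where
  "gamma_basis d i = (var_s * var_t) ^ i * (var_s + var_t) ^ (d - 2 * i)"

text \<open>These are the gamma coefficients of the Eulerian polynomial for permutations of
  \<open>Suc d\<close> points: the first argument is the degree, not the number of points.\<close>

fun eulerian_gamma :: "nat \<Rightarrow> nat \<Rightarrow> real" where
  "eulerian_gamma 0 i = (if i = 0 then 1 else 0)"
| "eulerian_gamma (Suc d) 0 = eulerian_gamma d 0"
| "eulerian_gamma (Suc d) (Suc i) =
     real (i + 2) * eulerian_gamma d (Suc i) + (2 * real d - 4 * real i) * eulerian_gamma d i"

text \<open>At the boundary \<open>2 * i = d\<close> the factor \<open>2 * d - 4 * i\<close>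
  vanishes, so nothing leaks beyond the middle index.\<close>

lemma eulerian_gamma_eq_0: "2 * i > d \<Longrightarrow> eulerian_gamma d i = 0"
proof (induction d i rule: eulerian_gamma.induct)
  case (3 d i)
  then show ?case by (cases "2 * i > d") auto
qed auto

text \<open>The factor \<open>2 * d - 4 * i\<close> is negative only for \<open>2 * i > d\<close>,
  where it multiplies a zero coefficient.\<close>

lemma eulerian_gamma_nonneg: "eulerian_gamma d i \<ge> 0"
proof (induction d i rule: eulerian_gamma.induct)
  case (3 d i)
  then show ?case by (cases "2 * i > d") (auto simp: eulerian_gamma_eq_0)
qed auto

text \<open>Put \<open>j = d - 2 i\<close> and \<open>q = s + t\<close>. For \<open>j > 0\<close>, t
  d/dt multiplies the basis element by \<open>i + j t / q\<close>, so the whole operator multiplies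
  it by \<open>(i + 1) q + j t + (s - t) j t / q = (i + 1) q + 2 j s t / q\<close>.\<close>

lemma eulerian_operator_gamma_basis:
  assumes "2 * i \<le> d"
  shows "(var_s + of_nat (Suc d) * var_t) * gamma_basis d i
      + (var_s - var_t) * (var_t * pderiv (gamma_basis d i)) =
    of_nat (Suc i) * gamma_basis (Suc d) i
      + (2 * of_nat d - 4 * of_nat i) * gamma_basis (Suc d) (Suc i)"
proof -
  define j where "j = d - 2 * i"
  have d: "d = j + 2 * i" using assms by (simp add: j_def)
  have st: "var_t * pderiv ((var_s * var_t) ^ i) = of_nat i * (var_s * var_t) ^ i"
    by (induction i) (simp_all add: pderiv_mult algebra_simps)
  have "var_t * pderiv (gamma_basis d i) =
      (var_s + var_t) ^ j * (var_t * pderiv ((var_s * var_t) ^ i))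
        + (var_s * var_t) ^ i * (var_t * pderiv ((var_s + var_t) ^ j))"
    by (simp add: gamma_basis_def d pderiv_mult algebra_simps)
  also have "\<dots> = (var_s + var_t) ^ j * (of_nat i * (var_s * var_t) ^ i)
        + (var_s * var_t) ^ i * (var_t * pderiv ((var_s + var_t) ^ j))"
    by (simp only: st)
  finally have pd: "var_t * pderiv (gamma_basis d i) = \<dots>" .
  show ?thesis
  proof (cases j)
    \<comment> \<open>Here the exponent in \<open>gamma_basis (Suc d) (Suc i)\<close> is truncated,
      but its coefficient \<open>2 * d - 4 * i\<close> is zero.\<close>
    case 0
    then show ?thesis
      unfolding pd by (simp add: d gamma_basis_def algebra_simps)
  next
    case (Suc l)
    have pv: "pderiv ((var_s + var_t) ^ Suc l) = of_nat (Suc l) * (var_s + var_t) ^ l"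
      by (simp add: pderiv_power_Suc pderiv_add of_nat_poly del: power_Suc)
    define A where "A = (var_s * var_t) ^ i"
    define B where "B = (var_s + var_t) ^ l"
    have "gamma_basis d i = A * ((var_s + var_t) * B)"
      "gamma_basis (Suc d) i = A * ((var_s + var_t) * ((var_s + var_t) * B))"
      "gamma_basis (Suc d) (Suc i) = var_s * var_t * A * B"
      by (simp_all add: gamma_basis_def d Suc A_def B_def)
    then show ?thesis
      unfolding pd unfolding Suc pv unfolding power_Suc A_def[symmetric] B_def[symmetric]
      by (simp add: d Suc algebra_simps)
  qed
qed

lemma smult_const: "smult c f = [:c:] * f"
  by simp

lemma smult_const_add: "smult [:a + b:] f = smult [:a:] f + smult [:b:] f"
  by (simp flip: smult_add_left)

lemma smult_const_diff:
  fixes a b :: "'a::comm_ring"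
  shows "smult [:a - b:] f = smult [:a:] f - smult [:b:] f"
  by (simp flip: smult_diff_left)

text \<open>The recurrence operator commutes with constant factors and maps each basis element of
  degree \<open>d\<close> that occurs to two of degree \<open>Suc d\<close>; collecting coefficients
  gives the recursion of \<open>eulerian_gamma\<close>. The range \<open>i \<le> d\<close> passes
  the middle index, with zero coefficients there, to keep the index shift simple.\<close>

lemma exc_poly_gamma_expansion:
  "exc_poly 1 (Suc d) = (\<Sum>i\<le>d. smult [:eulerian_gamma d i:] (gamma_basis d i))"
proof (induction d)
  case 0
  then show ?case by (simp add: exc_poly_1 gamma_basis_def one_pCons)
next
  case (Suc d)
  let ?g = "eulerian_gamma" and ?G = "gamma_basis (Suc d)"
  define D where "D f = (var_s + of_nat (Suc d) * var_t) * f + (var_s - var_t) * (var_t * pderiv f)"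
    for f
  have D_sum: "D (sum f A) = (\<Sum>i\<in>A. D (f i))" for f and A :: "nat set"
    by (simp add: D_def sum.distrib sum_distrib_left higher_pderiv_sum[of 1, simplified])
  have D_smult: "D (smult [:c:] f) = smult [:c:] (D f)" for c f
    by (simp add: D_def pderiv_smult smult_add_right)
  have summand: "smult [:?g d i:] (D (gamma_basis d i)) =
      smult [:real (Suc i) * ?g d i:] (?G i)
      + smult [:(2 * real d - 4 * real i) * ?g d i:] (?G (Suc i))" for i
  proof (cases "2 * i \<le> d")
    case True
    have "2 * of_nat d - 4 * of_nat i = [:[:2 * real d - 4 * real i:]:]"
      by (simp add: of_nat_poly numeral_poly)
    moreover have "of_nat (Suc i) = [:[:real (Suc i):]:]"
      by (simp only: of_nat_poly)
    ultimately have "D (gamma_basis d i) = [:[:real (Suc i):]:] * ?G i +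
       [:[:2 * real d - 4 * real i:]:] * ?G (Suc i)"
      using eulerian_operator_gamma_basis[OF True] by (simp only: D_def)
    then show ?thesis by (simp add: smult_add_right mult_ac)
  qed (simp add: eulerian_gamma_eq_0)
  have "exc_poly 1 (Suc (Suc d)) = D (exc_poly 1 (Suc d))"
    by (subst exc_poly_Suc) (simp_all add: D_def)
  also have "\<dots> = (\<Sum>i\<le>d. smult [:real (Suc i) * ?g d i:] (?G i))
      + (\<Sum>i\<le>d. smult [:(2 * real d - 4 * real i) * ?g d i:] (?G (Suc i)))"
    by (simp only: Suc.IH D_sum D_smult summand sum.distrib)
  \<comment> \<open>The added summand is zero; once \<open>i = 0\<close> is split off, both sums run
    over the same range.\<close>
  also have "(\<Sum>i\<le>d. smult [:real (Suc i) * ?g d i:] (?G i)) =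
      (\<Sum>i\<le>Suc d. smult [:real (Suc i) * ?g d i:] (?G i))"
    by (simp add: eulerian_gamma_eq_0)
  also have "\<dots> = smult [:?g d 0:] (?G 0)
      + (\<Sum>i\<le>d. smult [:real (i + 2) * ?g d (Suc i):] (?G (Suc i)))"
    by (subst sum.atMost_Suc_shift) (simp add: add_ac)
  finally show ?case
    by (subst sum.atMost_Suc_shift) (simp add: sum.distrib smult_const_add)
qed

section \<open>Lower bound for the unsigned gamma coefficients\<close>

text \<open>By Pascal's rule the left side for \<open>Suc m\<close> and \<open>Suc k\<close> is at
  most \<open>a + 4 * b\<close>, where \<open>a\<close> and \<open>b\<close> are the coefficients of
  degree \<open>2 * m\<close> at \<open>Suc k\<close> and \<open>k\<close>; two recursion steps
  produce at least that. For \<open>m = 1\<close>, \<open>i = 1\<close> the bound fails (4 against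
  2), so the induction starts at 2, with equality at \<open>i = 2\<close>.\<close>

lemma eulerian_gamma_ge:
  "m \<ge> 2 \<Longrightarrow> 4 ^ i * real (m choose i) \<le> eulerian_gamma (2 * m) i"
proof (induction m arbitrary: i rule: dec_induct)
  case base
  consider "i = 0" | "i = 1" | "i = 2" | "i > 2" by linarith
  then show ?case
    by cases (auto simp add: numeral_eq_Suc binomial_eq_0 eulerian_gamma_nonneg
        simp del: eulerian_gamma.simps, auto simp: numeral_eq_Suc)
next
  case (step m)
  let ?g = "eulerian_gamma"
  show ?case
  proof (cases i)
    case 0
    then show ?thesis using step.IH[of 0] by simp
  next
    case (Suc k)
    show ?thesis
    proof (cases "k \<le> m")
      case False
      then have "Suc m choose i = 0" using Suc by simp
      then show ?thesis
        using eulerian_gamma_nonneg[of "2 * Suc m" i] by (simp only: of_nat_0 mult_zero_right)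
    next
      case True
      \<comment> \<open>The factors \<open>2 * d - 4 * k\<close> of the two recursion steps, at
        \<open>d = 2 * m\<close> and \<open>d = 2 * m + 1\<close>, are \<open>4 * r\<close> and
        \<open>4 * r + 2\<close>.\<close>
      define r where "r = real m - real k"
      have r: "r \<ge> 0" using True by (simp add: r_def)
      define a b where "a = ?g (2 * m) (Suc k)" and "b = ?g (2 * m) k"
      have ab: "a \<ge> 0" "b \<ge> 0" by (simp_all add: a_def b_def eulerian_gamma_nonneg)
      have upper: "?g (Suc (2 * m)) (Suc k) \<ge> a + 4 * r * b"
        using ab by (simp add: a_def b_def r_def algebra_simps)
      have lower: "?g (Suc (2 * m)) k \<ge> (real k + 1) * b"
      proof (cases k)
        case (Suc l)
        have "(2 * real (2 * m) - 4 * real l) * ?g (2 * m) l \<ge> 0"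
          using True Suc by (intro mult_nonneg_nonneg eulerian_gamma_nonneg) auto
        then show ?thesis by (simp add: b_def Suc algebra_simps)
      qed (simp add: b_def)
      \<comment> \<open>The right side is the multiple of \<open>b\<close> that two steps guarantee.
        At \<open>k = m\<close> it is \<open>2 * (m + 1)\<close>; for \<open>k < m\<close> its first
        product alone is at least 8.\<close>
      have coeff: "4 \<le> (real k + 2) * (4 * r) + (4 * r + 2) * (real k + 1)"
      proof (cases "k = m")
        case True
        then show ?thesis using step.hyps by (simp add: r_def)
      next
        case False
        then have "r \<ge> 1" using \<open>k \<le> m\<close> by (simp add: r_def)
        then have "2 * 4 \<le> (real k + 2) * (4 * r)" by (intro mult_mono) auto
        moreover have "0 \<le> (4 * r + 2) * (real k + 1)" using r by simp
        ultimately show ?thesis by linarith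
      qed
      have "4 ^ i * real (Suc m choose i) =
          4 ^ Suc k * real (m choose Suc k) + 4 * (4 ^ k * real (m choose k))"
        by (simp add: Suc algebra_simps)
      also have "\<dots> \<le> a + 4 * b"
        unfolding a_def b_def by (intro add_mono mult_left_mono step.IH) auto
      also have "\<dots> \<le> a + ((real k + 2) * (4 * r) + (4 * r + 2) * (real k + 1)) * b"
        using coeff ab by (intro add_left_mono mult_right_mono)
      also have "\<dots> \<le> (real k + 2) * (a + 4 * r * b) + (4 * r + 2) * ((real k + 1) * b)"
        using ab by (simp add: algebra_simps)
      also have "\<dots> \<le> (real k + 2) * ?g (Suc (2 * m)) (Suc k) + (4 * r + 2) * ?g (Suc (2 * m)) k"
        using r by (intro add_mono mult_left_mono upper lower) auto
      also have "\<dots> = ?g (2 * Suc m) i"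
        by (simp add: Suc r_def algebra_simps del: eulerian_gamma.simps(3))
          (simp add: algebra_simps)
      finally show ?thesis .
    qed
  qed
qed

section \<open>Gamma expansion of the signed sum\<close>

lemma diff_power_gamma_expansion:
  "(var_s - var_t) ^ (2 * m) =
    (\<Sum>i\<le>m. smult [:(- 4) ^ i * real (m choose i):] (gamma_basis (2 * m) i))"
proof -
  have "(var_s - var_t) ^ (2 * m) = (- 4 * (var_s * var_t) + (var_s + var_t) ^ 2) ^ m"
    unfolding power_mult by (simp add: power2_eq_square algebra_simps)
  also have "\<dots> = (\<Sum>i\<le>m. of_nat (m choose i) * (- 4 * (var_s * var_t)) ^ i
      * ((var_s + var_t) ^ 2) ^ (m - i))"
    by (rule binomial_ring)
  also have "\<dots> = (\<Sum>i\<le>m. smult [:(- 4) ^ i * real (m choose i):] (gamma_basis (2 * m) i))"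
  proof (rule sum.cong[OF refl])
    fix i
    have "[:[:(- 4) ^ i * real (m choose i):]:] = (- 4) ^ i * of_nat (m choose i)"
      by (simp add: of_nat_poly numeral_poly poly_const_pow)
    then have "smult [:(- 4) ^ i * real (m choose i):] (gamma_basis (2 * m) i) =
        (- 4) ^ i * of_nat (m choose i) * gamma_basis (2 * m) i"
      by (metis smult_const)
    moreover have "(- 4 * (var_s * var_t)) ^ i = (- 4) ^ i * (var_s * var_t) ^ i"
      by (rule power_mult_distrib)
    moreover have "((var_s + var_t) ^ 2) ^ (m - i) = (var_s + var_t) ^ (2 * m - 2 * i)"
      by (simp add: diff_mult_distrib2 flip: power_mult)
    ultimately show "of_nat (m choose i) * (- 4 * (var_s * var_t)) ^ i
        * ((var_s + var_t) ^ 2) ^ (m - i) =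
        smult [:(- 4) ^ i * real (m choose i):] (gamma_basis (2 * m) i)"
      by (simp only: gamma_basis_def mult_ac)
  qed
  finally show ?thesis .
qed

section \<open>Homogeneity and the two alternating halves\<close>

lemma homogeneous_add: "homogeneous d f \<Longrightarrow> homogeneous d g \<Longrightarrow> homogeneous d (f + g)"
  unfolding homogeneous_def by (metis add.right_neutral coeff_add)

lemma homogeneous_sum: "(\<And>x. x \<in> A \<Longrightarrow> homogeneous d (f x)) \<Longrightarrow> homogeneous d (sum f A)"
  by (induction A rule: infinite_finite_induct) (auto intro!: homogeneous_add, auto simp: homogeneous_def)

lemma homogeneous_monomial: "homogeneous (a + b) (var_t ^ a * var_s ^ b)"
proof -
  have "var_t ^ a = monom 1 a"
    by (simp add: var_t_def monom_altdef)
  moreover have "var_s ^ b = [:monom 1 b:]"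
    by (simp add: var_s_def monom_altdef poly_const_pow)
  ultimately show ?thesis
    by (auto simp: homogeneous_def coeff_monom smult_monom split: if_splits)
qed

lemma homogeneous_exc_monomial:
  assumes "p permutes {1..Suc d}"
  shows "homogeneous d (var_t ^ exc (Suc d) p * var_s ^ (nexc (Suc d) p - 1))"
proof -
  have "d = exc (Suc d) p + (nexc (Suc d) p - 1)"
    using exc_less[OF assms] by (simp add: nexc_eq)
  then show ?thesis
    using homogeneous_monomial by metis
qed

text \<open>Stated for twice \<open>f\<close>, because adding or subtracting the unsigned and signed
  sums yields twice one of the two polynomials.\<close>

lemma gamma_positiveI:
  assumes "homogeneous (2 * m) f"
    and "smult [:2:] f = (\<Sum>i\<le>m. smult [:g i:] (gamma_basis (2 * m) i))"
    and "\<And>i. g i \<ge> 0"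
  shows "gamma_positive_with_center f (real m)"
proof -
  have "f = smult [:1 / 2:] (smult [:2:] f)"
    by (simp flip: one_pCons)
  also have "\<dots> = (\<Sum>i\<le>m. smult [:g i / 2:] (gamma_basis (2 * m) i))"
    unfolding assms(2) unfolding smult_const sum_distrib_left by simp
  finally show ?thesis
    using assms(1,3) unfolding gamma_positive_with_center_def gamma_basis_def
    by (intro exI[of _ "2 * m"] conjI exI[of _ "\<lambda>i. g i / 2"]) auto
qed

theorem theorem1:
  fixes n :: nat
  assumes "odd n" and "n \<ge> 5"
  shows "gamma_positive_with_center (AExc_plus n) ((real n - 1) / 2) \<and>
         gamma_positive_with_center (AExc_minus n) ((real n - 1) / 2)"
proof -
  obtain m where n: "n = Suc (2 * m)"
    using \<open>odd n\<close> by (auto elim: oddE)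
  have m: "m \<ge> 2" using n \<open>n \<ge> 5\<close> by simp
  let ?g = "eulerian_gamma (2 * m)"
  define w where "w p = var_t ^ exc n p * var_s ^ (nexc n p - 1)" for p
  have plus: "AExc_plus n = (\<Sum>p | p permutes {1..n} \<and> evenperm p. w p)"
    unfolding AExc_plus_def w_def
    by (rule sum.cong[OF _ refl]) (auto simp: alt_group_carrier)
  have minus: "AExc_minus n = (\<Sum>p | p permutes {1..n} \<and> \<not> evenperm p. w p)"
    unfolding AExc_minus_def w_def
    by (rule sum.cong[OF _ refl]) (auto simp: alt_group_carrier sym_group_carrier)
  have split: "exc_poly e n = AExc_plus n + e * AExc_minus n" for e
  proof -
    have "exc_poly e n = (\<Sum>p | p permutes {1..n}. if evenperm p then w p else e * w p)"
      unfolding exc_poly_def w_def by (intro sum.cong) auto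
    also have "\<dots> = (\<Sum>p | p permutes {1..n} \<and> evenperm p. w p)
        + (\<Sum>p | p permutes {1..n} \<and> \<not> evenperm p. e * w p)"
      by (subst sum.If_cases) (auto simp: finite_permutations Collect_conj_eq Collect_neg_eq)
    finally show ?thesis
      unfolding plus minus sum_distrib_left .
  qed
  have two: "smult [:2:] f = f + f" for f :: "real bipoly"
    using smult_const_add[of 1 1 f] by (simp flip: one_pCons)
  have S: "AExc_plus n + AExc_minus n = (\<Sum>i\<le>m. smult [:?g i:] (gamma_basis (2 * m) i))"
  proof -
    have "exc_poly 1 n = (\<Sum>i\<le>2 * m. smult [:?g i:] (gamma_basis (2 * m) i))"
      unfolding n by (rule exc_poly_gamma_expansion)
    \<comment> \<open>Cutting at \<open>m\<close>, half the degree, matches the range of the signed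
      expansion.\<close>
    also have "\<dots> = (\<Sum>i\<le>m. smult [:?g i:] (gamma_basis (2 * m) i))"
      by (rule sum.mono_neutral_right) (auto simp: eulerian_gamma_eq_0)
    finally show ?thesis using split[of 1] by simp
  qed
  have T: "AExc_plus n - AExc_minus n =
      (\<Sum>i\<le>m. smult [:(- 4) ^ i * real (m choose i):] (gamma_basis (2 * m) i))"
    using split[of "-1"] by (simp add: n exc_poly_minus diff_power_gamma_expansion)
  \<comment> \<open>The bound on the absolute value serves both the even half (sum of coefficients)
    and the odd half (difference).\<close>
  have bound: "\<bar>(- 4) ^ i * real (m choose i)\<bar> \<le> ?g i" for i
    using eulerian_gamma_ge[OF m, of i] by (simp add: abs_mult power_abs)
  have "gamma_positive_with_center (AExc_plus n) (real m)"
  proof (rule gamma_positiveI)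
    show "homogeneous (2 * m) (AExc_plus n)"
      unfolding plus w_def unfolding n
      by (rule homogeneous_sum, rule homogeneous_exc_monomial) simp
    have "smult [:2:] (AExc_plus n) =
        (AExc_plus n + AExc_minus n) + (AExc_plus n - AExc_minus n)"
      by (simp add: two)
    then show "smult [:2:] (AExc_plus n) =
        (\<Sum>i\<le>m. smult [:?g i + (- 4) ^ i * real (m choose i):] (gamma_basis (2 * m) i))"
      unfolding S T by (simp add: sum.distrib smult_const_add)
    show "?g i + (- 4) ^ i * real (m choose i) \<ge> 0" for i
      using bound[of i] by linarith
  qed
  moreover have "gamma_positive_with_center (AExc_minus n) (real m)"
  proof (rule gamma_positiveI)
    show "homogeneous (2 * m) (AExc_minus n)"
      unfolding minus w_def unfolding n
      by (rule homogeneous_sum, rule homogeneous_exc_monomial) simp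
    have "smult [:2:] (AExc_minus n) =
        (AExc_plus n + AExc_minus n) - (AExc_plus n - AExc_minus n)"
      by (simp add: two)
    then show "smult [:2:] (AExc_minus n) =
        (\<Sum>i\<le>m. smult [:?g i - (- 4) ^ i * real (m choose i):] (gamma_basis (2 * m) i))"
      unfolding S T by (simp add: sum_subtractf smult_const_diff)
    show "?g i - (- 4) ^ i * real (m choose i) \<ge> 0" for i
      using bound[of i] by linarith
  qed
  ultimately show ?thesis by (simp add: n)
qed

end
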